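(* Let $T:\mathbb{T}^2\to\mathbb{T}^2$ be a hyperbolic toral automorphism whose eigenvalues are positive real numbers, let $B$ be an open parallelogram constructed for $T$ as described in the context, and let $$F := F_T(B) := \mathbb{T}^2 \setminus \bigcup_{n=0}^\infty T^{-n}(B).$$ Then any nonempty (relatively) open subset of $F$ contains a piece of space parallel to the stable manifold.
   Context: A piece of space parallel to the stable manifold is a translate in $\mathbb{T}^2$ of a (small, nondegenerate) open segment contained in $E^-$. Notation. $\mathbb{T}^2=\mathbb{R}^2/\mathbb{Z}^2$; a hyperbolic toral automorphism is induced by a matrix in $GL_2(\mathbb{Z})$ with no eigenvalue of modulus $1$. For $z\in\mathbb{T}^2$, $E^-(z)$ and $E^+(z)$ are the stable and unstable manifolds of $T$ through $z$ (the images in $\mathbb{T}^2$ of the lines through a lift of $z$ parallel to the contracting, resp. expanding, eigenline), and $E^\pm:=E^\pm(\boldsymbol{0})$. For $\alpha>0$, $P(\alpha,z)\subset E^-(z)$ is the closed ball (segment) in $E^-(z)$ around $z$ of radius $\alpha$. Construction of $B$. Everything takes place in a small enough neighborhood of $\boldsymbol{0}$, so that locally one is in $\mathbb{R}^2$. Pick a small open parallelogram $B'$ with one vertex at $\boldsymbol{0}$ whose two edges $B'^-$ and $B'^+$ at $\boldsymbol{0}$ are small closed segments of $E^-$ and $E^+$, respectively. Pick a rational point $y_0\in B'$ and let $\{y_0,\dots,y_{N-1}\}$ be its (finite) orbit under $T$. For each $p$ let $\alpha_p>0$ be the smallest number such that $P(\alpha_p,y_p)$ meets $B'^+$. Let $\alpha_*=\min_p\alpha_p$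 and $I=\{p:\alpha_p=\alpha_*\}$. ($B'$ is small enough that each $P(\alpha_*,y_p)$ meets $B'^+$ in at most one point, which is then one of its endpoints.) If at least one of the segments $P(\alpha_*,y_i)$, $i\in I$, meets the open set $B'$, put $\beta=\alpha_*$. Otherwise choose $\beta$ slightly bigger than $\alpha_*$ so that every $P(\beta,y_i)$, $i\in I$, meets $B'$ but $P(\beta,y_p)$ does not meet $B'^+$ for any $p\notin I$. Among the indices $i\in I$ for which $P(\beta,y_i)$ meets $B'$, let $q$ be the (unique) one for which the intersection point of $P(\beta,y_i)$ with $B'^+$ is nearest to $\boldsymbol{0}$, and call this intersection point $x$ (one has $x\neq\boldsymbol{0}$). Let $\mathcal{E}\subset B'^+$ be the closed segment between $\boldsymbol{0}$ and $x$. Finally $B\subset B'$ is an open parallelogram having $\mathcal{E}$ as an edge and its other pair of edges parallel to $E^-$, one of them, $B_{\boldsymbol{0}}:=\overline{B}\cap B'^-$, having $\boldsymbol{0}$ as an endpoint and the other one, $B_x$, having $x$ as an endpoint, chosen thin enough that $B_x\subset P(\beta,y_q)$ and that $B$ does not meet $P(\beta,y_p)$ for any $0\le p\le N-1$.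
   Formalization: Adds the assumption that no forward image of the edge E of B meets the edge of B opposite to E; this excludes only countably many widths of B. For some permitted widths the claim is false: F can lie in an unstable segment near a point of E. *)

theory Defs
  imports "HOL-Analysis.Analysis"
begin

section \<open>The torus\<close>

definition int_lattice :: "(real^2) set" where
  "int_lattice = {k. \<forall>i. k $ i \<in> \<int>}"

lemma int_lattice_0: "0 \<in> int_lattice"
  and int_lattice_add: "k \<in> int_lattice \<Longrightarrow> l \<in> int_lattice \<Longrightarrow> k + l \<in> int_lattice"
  and int_lattice_uminus: "k \<in> int_lattice \<Longrightarrow> - k \<in> int_lattice"
  by (auto simp: int_lattice_def)

lemma int_lattice_diff: "k \<in> int_lattice \<Longrightarrow> l \<in> int_lattice \<Longrightarrow> k - l \<in> int_lattice"
  by (auto simp: int_lattice_def)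

lemma int_lattice_matrix:
  fixes A :: "int^2^2"
  assumes "k \<in> int_lattice"
  shows "map_matrix of_int A *v k \<in> int_lattice"
  using assms by (simp add: int_lattice_def matrix_vector_mult_def Ints_sum Ints_mult)

quotient_type torus = "real^2" / "\<lambda>x y. x - y \<in> int_lattice"
  morphisms rep_torus torus_proj
proof (rule equivpI)
  show "reflp (\<lambda>x y. x - y \<in> int_lattice)"
    by (simp add: reflp_def int_lattice_0)
  show "symp (\<lambda>x y. x - y \<in> int_lattice)"
    by (rule sympI) (drule int_lattice_uminus, simp)
  show "transp (\<lambda>x y. x - y \<in> int_lattice)"
    by (rule transpI) (drule (1) int_lattice_add, simp)
qed

instantiation torus :: ab_group_add
begin

lift_definition zero_torus :: torus is "0 :: real^2" .

lift_definition plus_torus :: "torus \<Rightarrow> torus \<Rightarrow> torus" is "(+)"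
  by (drule (1) int_lattice_add) (simp add: algebra_simps)

lift_definition uminus_torus :: "torus \<Rightarrow> torus" is uminus
  by (drule int_lattice_uminus) (simp add: algebra_simps)

lift_definition minus_torus :: "torus \<Rightarrow> torus \<Rightarrow> torus" is "(-)"
  by (drule (1) int_lattice_diff) (simp add: algebra_simps)

instance
  by standard (transfer; simp add: algebra_simps int_lattice_0)+

end

text \<open>The quotient topology.\<close>

instantiation torus :: topological_space
begin

definition open_torus :: "torus set \<Rightarrow> bool" where
  "open_torus U \<longleftrightarrow> open (torus_proj -` U)"

instance
  by standard (auto simp: open_torus_def vimage_Union)

end

section \<open>Hyperbolic toral automorphisms\<close>

lift_definition toral_map :: "int^2^2 \<Rightarrow> torus \<Rightarrow> torus" is "\<lambda>A v. map_matrix of_int A *v v"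
  by (simp add: int_lattice_matrix flip: matrix_vector_mult_diff_distrib)

definition is_eigenvalue :: "int^2^2 \<Rightarrow> complex \<Rightarrow> bool" where
  "is_eigenvalue A c \<longleftrightarrow> (\<exists>v :: complex^2. v \<noteq> 0 \<and> map_matrix of_int A *v v = c *s v)"

text \<open>\<open>invertible\<close> is invertibility over the integers, so it expresses membership in
  the group of invertible integer matrices.\<close>

definition hyperbolic :: "int^2^2 \<Rightarrow> bool" where
  "hyperbolic A \<longleftrightarrow> invertible A \<and> (\<forall>c. is_eigenvalue A c \<longrightarrow> norm c \<noteq> 1)"

definition contracting_line :: "int^2^2 \<Rightarrow> (real^2) set" where
  "contracting_line A = {v. \<exists>l::real. \<bar>l\<bar> < 1 \<and> map_matrix of_int A *v v = l *\<^sub>R v}"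

definition expanding_line :: "int^2^2 \<Rightarrow> (real^2) set" where
  "expanding_line A = {v. \<exists>l::real. \<bar>l\<bar> > 1 \<and> map_matrix of_int A *v v = l *\<^sub>R v}"

definition stable_manifold :: "int^2^2 \<Rightarrow> torus \<Rightarrow> torus set" where
  "stable_manifold A z = (\<lambda>v. z + torus_proj v) ` contracting_line A"

definition unstable_manifold :: "int^2^2 \<Rightarrow> torus \<Rightarrow> torus set" where
  "unstable_manifold A z = (\<lambda>v. z + torus_proj v) ` expanding_line A"

text \<open>The ball is taken in the intrinsic metric of the leaf, so for a large radius it is a long
  segment winding around the torus.\<close>

definition stable_ball :: "int^2^2 \<Rightarrow> real \<Rightarrow> torus \<Rightarrow> torus set" where
  "stable_ball A r z = (\<lambda>v. z + torus_proj v) ` {v \<in> contracting_line A. norm v \<le> r}"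

text \<open>The segment \<open>S\<close> is an open segment of the immersed line \<open>stable_manifold A 0\<close>, given by its
  end points on the line in the plane.\<close>

definition stable_piece :: "int^2^2 \<Rightarrow> torus set \<Rightarrow> bool" where
  "stable_piece A X \<longleftrightarrow>
     (\<exists>z S a b. a \<in> contracting_line A \<and> b \<in> contracting_line A \<and> a \<noteq> b \<and>
        S = torus_proj ` open_segment a b \<and> X = (\<lambda>s. z + s) ` S)"

definition avoiding_set :: "(torus \<Rightarrow> torus) \<Rightarrow> torus set \<Rightarrow> torus set" where
  "avoiding_set T B = UNIV - (\<Union>n. (T ^^ n) -` B)"

section \<open>The construction of the parallelogram\<close>

text \<open>The open parallelogram with a vertex at the origin and with the two edges
  \<open>closed_segment 0 e\<close> and \<open>closed_segment 0 f\<close> there.\<close>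

definition parallelogram :: "real^2 \<Rightarrow> real^2 \<Rightarrow> (real^2) set" where
  "parallelogram e f = {s *\<^sub>R e + t *\<^sub>R f | s t. 0 < s \<and> s < 1 \<and> 0 < t \<and> t < 1}"

definition hitting_radius :: "int^2^2 \<Rightarrow> torus \<Rightarrow> torus set \<Rightarrow> real \<Rightarrow> bool" where
  "hitting_radius A z D r \<longleftrightarrow>
     0 < r \<and> stable_ball A r z \<inter> D \<noteq> {} \<and>
     (\<forall>r'>0. stable_ball A r' z \<inter> D \<noteq> {} \<longrightarrow> r \<le> r')"

text \<open>
  \<open>em\<close> and \<open>ep\<close> are the edge vectors of the auxiliary parallelogram \<open>B'\<close> along the contracting and
  expanding lines. On the ball of radius \<open>1/4\<close> the projection to the torus is an isometry for the
  flat metric, so inside it one may work in the plane; in particular balls of radius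
  \<open>Min (\<alpha> ` {..<N})\<close> meet the edge \<open>D\<close> of \<open>B'\<close> in at most one point.

  The result of the construction is \<open>torus_proj ` parallelogram e x\<close>: the edge \<open>E\<close> is
  \<open>closed_segment 0 x\<close>, the edges parallel to the contracting line are \<open>closed_segment 0 e\<close> and
  \<open>closed_segment x (x + e)\<close>. Here \<open>x\<close> is the lift to \<open>closed_segment 0 ep\<close> of the chosen
  intersection point.\<close>

definition constructed :: "int^2^2 \<Rightarrow> real^2 \<Rightarrow> real^2 \<Rightarrow> bool" where
  "constructed A e x \<longleftrightarrow>
    (\<exists>em ep w N y \<alpha> \<alpha>min I \<beta> q B' D.
      \<comment> \<open>the parallelogram \<open>B'\<close> and its edge \<open>D\<close> on the unstable manifold of the origin\<close>
      em \<in> contracting_line A \<and> em \<noteq> 0 \<and> ep \<in> expanding_line A \<and> ep \<noteq> 0 \<and>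
      closure (parallelogram em ep) \<subseteq> ball 0 (1/4) \<and>
      B' = torus_proj ` parallelogram em ep \<and>
      D = torus_proj ` closed_segment 0 ep \<and>
      \<comment> \<open>a rational point in \<open>B'\<close> and its orbit\<close>
      (\<forall>i. w $ i \<in> \<rat>) \<and> torus_proj w \<in> B' \<and>
      (\<forall>p. y p = (toral_map A ^^ p) (torus_proj w)) \<and>
      0 < N \<and> y N = y 0 \<and> inj_on y {..<N} \<and>
      \<comment> \<open>the minimal radius\<close>
      (\<forall>p<N. hitting_radius A (y p) D (\<alpha> p)) \<and>
      \<alpha>min = Min (\<alpha> ` {..<N}) \<and>
      I = {p. p < N \<and> \<alpha> p = \<alpha>min} \<and>
      \<comment> \<open>the radius \<open>\<beta>\<close>\<close>
      (if \<exists>i\<in>I. stable_ball A \<alpha>min (y i) \<inter> B' \<noteq> {}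
       then \<beta> = \<alpha>min
       else \<alpha>min < \<beta> \<and>
            (\<forall>i\<in>I. stable_ball A \<beta> (y i) \<inter> B' \<noteq> {}) \<and>
            (\<forall>i\<in>I. \<exists>!u. u \<in> stable_ball A \<beta> (y i) \<inter> D) \<and>
            (\<forall>p<N. p \<notin> I \<longrightarrow> stable_ball A \<beta> (y p) \<inter> D = {})) \<and>
      \<comment> \<open>the index \<open>q\<close> with intersection point nearest to the origin\<close>
      q \<in> I \<and> stable_ball A \<beta> (y q) \<inter> B' \<noteq> {} \<and>
      x \<in> closed_segment 0 ep \<and> torus_proj x \<in> stable_ball A \<beta> (y q) \<and>
      (\<forall>i\<in>I. stable_ball A \<beta> (y i) \<inter> B' \<noteq> {} \<longrightarrow>
         (\<forall>x'\<in>closed_segment 0 ep. torus_proj x' \<in> stable_ball A \<beta> (y i) \<longrightarrow> norm x \<le> norm x')) \<and>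
      \<comment> \<open>the thin parallelogram inside \<open>B'\<close>\<close>
      e \<in> closed_segment 0 em \<and> e \<noteq> 0 \<and>
      torus_proj ` closed_segment x (x + e) \<subseteq> stable_ball A \<beta> (y q) \<and>
      (\<forall>p<N. torus_proj ` parallelogram e x \<inter> stable_ball A \<beta> (y p) = {}))"

text \<open>
  The edge opposite to \<open>E\<close> must not lie on the part of the unstable manifold of the origin swept out
  by the forward images of \<open>E\<close>. This excludes only countably many widths \<open>e\<close>, but it cannot be
  dropped: if \<open>z\<close> is a point of the avoiding set in the interior of \<open>E\<close> and some forward image
  of \<open>z\<close> is in the interior of the opposite edge, then the stable segment through \<open>z\<close> enters
  the preimages of the parallelogram on both sides of \<open>z\<close>, and near \<open>z\<close> the avoiding set is contained
  in a segment of the unstable manifold.\<close>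

definition generic_width :: "int^2^2 \<Rightarrow> real^2 \<Rightarrow> real^2 \<Rightarrow> bool" where
  "generic_width A e x \<longleftrightarrow>
     (\<forall>n. (toral_map A ^^ n) ` torus_proj ` closed_segment 0 x
            \<inter> torus_proj ` closed_segment e (e + x) = {})"

end

theory Submission
  imports Defs
begin

text \<open>
  Let \<open>z\<close> be a point of the avoiding set, and let \<open>V\<close> be a small box adjacent to \<open>z\<close>, with sides
  parallel to the two eigenlines and lying on one side of the unstable line through \<open>z\<close>. If
  \<open>V\<close> meets some preimage of \<open>B\<close>, take the first such preimage, the \<open>n\<close>-th one. Both stable edges of \<open>B\<close>
  stay in the avoiding set, so wherever \<open>V\<close> contains a piece of a stable edge of the \<open>n\<close>-th preimage, that
  piece consists of points of the avoiding set. The box contains such a piece unless a whole unstable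
  fibre of \<open>V\<close> lies in the \<open>n\<close>-th preimage. The latter is impossible for large \<open>n\<close>, because the
  preimages become thinner than \<open>V\<close>; for the finitely many remaining \<open>n\<close> it is prevented by choosing
  \<open>V\<close> short in the stable direction and on the correct side of \<open>z\<close>. A side that is
  correct for all \<open>n\<close> at once exists because, for a generic width, the forward orbit of \<open>z\<close> does not hit
  both unstable edges of \<open>B\<close>.
\<close>

section \<open>The projection to the torus and the integer lattice\<close>

lemma torus_proj_in_image_iff: "torus_proj p \<in> torus_proj ` S \<longleftrightarrow> (\<exists>q\<in>S. p - q \<in> int_lattice)"
  by (auto simp: image_iff torus.abs_eq_iff)

lemma torus_proj_surj: "\<exists>v. z = torus_proj v"
  by (metis Quotient_abs_rep Quotient_torus)

lemma torus_proj_lattice: "p - q \<in> int_lattice \<Longrightarrow> torus_proj p = torus_proj q"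
  by (simp add: torus.abs_eq_iff)

lemma closed_int_lattice: "closed int_lattice"
proof -
  have "int_lattice = (\<Inter>i. (\<lambda>k :: real^2. k $ i) -` \<int>)"
    by (auto simp: int_lattice_def)
  moreover have "closed ((\<lambda>k :: real^2. k $ i) -` \<int>)" for i
    by (intro closed_vimage closed_Ints continuous_intros)
  ultimately show ?thesis
    by (metis closed_INT)
qed

lemma int_lattice_norm_less_1:
  assumes "k \<in> int_lattice" "norm k < 1"
  shows "k = 0"
proof -
  have "k $ i = 0" for i
  proof -
    have "\<bar>k $ i\<bar> < 1"
      using component_le_norm_cart[of k i] assms(2) by linarith
    then show ?thesis
      using assms(1) Ints_nonzero_abs_less1 by (auto simp: int_lattice_def)
  qed
  then show ?thesis
    by (simp add: vec_eq_iff)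
qed

lemma torus_proj_inj_on_ball: "inj_on torus_proj (ball 0 (1/4))"
proof (rule inj_onI)
  fix u w :: "real^2"
  assume "u \<in> ball 0 (1/4)" "w \<in> ball 0 (1/4)" "torus_proj u = torus_proj w"
  moreover from this have "norm (u - w) < 1"
    using norm_triangle_ineq4[of u w] by (simp add: dist_norm)
  ultimately show "u = w"
    using int_lattice_norm_less_1[of "u - w"] by (simp add: torus.abs_eq_iff)
qed

section \<open>Iterates and eigenvectors of the toral map\<close>

lemma funpow_diff_apply: "n \<le> i \<Longrightarrow> (f ^^ (i - n)) ((f ^^ n) z) = (f ^^ i) z"
  by (metis comp_apply funpow_add le_add_diff_inverse2)

lemma toral_map_funpow_proj:
  "(toral_map A ^^ n) (torus_proj v) = torus_proj (((*v) (map_matrix of_int A) ^^ n) v)"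
  by (induction n) (simp_all add: toral_map.abs_eq)

lemma funpow_eigen:
  fixes M :: "real^2^2"
  assumes "M *v e = l *\<^sub>R e" "M *v x = m *\<^sub>R x"
  shows "((*v) M ^^ n) (v + s *\<^sub>R e + t *\<^sub>R x)
    = ((*v) M ^^ n) v + (l ^ n * s) *\<^sub>R e + (m ^ n * t) *\<^sub>R x"
  by (induction n)
    (simp_all add: assms matrix_vector_right_distrib
      matrix_vector_mult_scaleR mult_ac)

lemma toral_map_funpow_eigen:
  assumes "map_matrix of_int A *v e = l *\<^sub>R e"
  shows "(toral_map A ^^ n) (torus_proj (s *\<^sub>R e)) = torus_proj ((l ^ n * s) *\<^sub>R e)"
proof -
  have "((*v) (map_matrix of_int A) ^^ n) 0 = (0 :: real^2)"
    by (induction n) simp_all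
  then show ?thesis
    using funpow_eigen[OF assms, of 0 0 n 0 s 0] by (simp add: toral_map_funpow_proj)
qed

text \<open>The inverse matrix is again integral, so it acts on the torus and gives a left inverse
  there.\<close>

lemma toral_map_inj:
  assumes "invertible A"
  shows "inj (toral_map A)"
proof -
  obtain C where C: "C ** A = mat 1"
    using assms by (auto simp: invertible_def)
  have "map_matrix of_int C ** map_matrix of_int A = (mat 1 :: real^2^2)"
  proof -
    have "map_matrix of_int (C ** A) = (map_matrix of_int C ** map_matrix of_int A :: real^2^2)"
      by (simp add: vec_eq_iff matrix_matrix_mult_def)
    moreover have "map_matrix of_int (mat 1 :: int^2^2) = (mat 1 :: real^2^2)"
      by (simp add: vec_eq_iff mat_def)
    ultimately show ?thesis
      by (simp add: C)
  qed
  then have "toral_map C (toral_map A z) = z" for z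
    using torus_proj_surj[of z] by (auto simp: toral_map.abs_eq matrix_vector_mul_assoc)
  then show ?thesis
    by (metis injI)
qed

text \<open>Carries a condition on complex eigenvalues over to the real multipliers in
  \<open>contracting_line\<close> and \<open>expanding_line\<close>.\<close>

lemma real_eigenvector_is_eigenvalue:
  assumes "map_matrix of_int A *v v = l *\<^sub>R (v :: real^2)" "v \<noteq> 0"
  shows "is_eigenvalue A (of_real l)"
  unfolding is_eigenvalue_def
proof (intro exI conjI)
  let ?w = "(\<chi> i. of_real (v $ i)) :: complex^2"
  show "?w \<noteq> 0"
    using assms(2) by (simp add: vec_eq_iff)
  show "map_matrix of_int A *v ?w = of_real l *s ?w"
    unfolding vec_eq_iff
  proof
    fix i
    have "of_real ((map_matrix of_int A *v v) $ i) = (of_real ((l *\<^sub>R v) $ i) :: complex)"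
      using assms(1) by simp
    then show "(map_matrix of_int A *v ?w) $ i = (of_real l *s ?w) $ i"
      by (simp add: matrix_vector_mult_def)
  qed
qed

section \<open>Lines along the edge vectors, and orbits through the edges\<close>

lemma away_from_translates:
  assumes "compact S" "torus_proj u \<notin> torus_proj ` S"
  obtains \<delta> where "\<delta> > 0"
    and "\<And>r. \<bar>r\<bar> < \<delta> \<Longrightarrow> torus_proj (u + r *\<^sub>R e) \<notin> torus_proj ` S"
proof -
  let ?C = "torus_proj -` torus_proj ` S"
  \<comment> \<open>The full preimage is the sum of a compact set and the closed lattice, hence
    closed, and \<open>u\<close> has positive distance from it.\<close>
  have "?C = (\<Union>a\<in>S. \<Union>k\<in>int_lattice. {a + k})"
  proof (intro set_eqI)
    fix w
    have "w - a \<in> int_lattice \<longleftrightarrow> (\<exists>k\<in>int_lattice. w = a + k)" for a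
      by (metis add_diff_cancel_left' diff_add_cancel add.commute)
    then show "w \<in> ?C \<longleftrightarrow> w \<in> (\<Union>a\<in>S. \<Union>k\<in>int_lattice. {a + k})"
      by (simp add: torus_proj_in_image_iff)
  qed
  then have "closed ?C"
    using compact_closed_sums[OF assms(1) closed_int_lattice] by simp
  then have "open (- ?C)"
    by (rule open_Compl)
  with assms(2) obtain d where d: "d > 0" "ball u d \<subseteq> - ?C"
    by (auto elim!: openE)
  show ?thesis
  proof (rule that)
    show "d / (norm e + 1) > 0"
      using d(1) by (simp add: add_nonneg_pos)
    fix r assume "\<bar>r\<bar> < d / (norm e + 1)"
    then have "\<bar>r\<bar> * (norm e + 1) < d"
      by (simp add: pos_less_divide_eq add_nonneg_pos)
    moreover have "\<bar>r\<bar> * norm e \<le> \<bar>r\<bar> * (norm e + 1)"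
      by (intro mult_left_mono) auto
    ultimately have "norm (r *\<^sub>R e) < d"
      by simp
    then have "u + r *\<^sub>R e \<in> ball u d"
      by (simp add: dist_norm)
    then show "torus_proj (u + r *\<^sub>R e) \<notin> torus_proj ` S"
      using d(2) by blast
  qed
qed

text \<open>Moving along \<open>e\<close>, one can enter a translate of the parallelogram only
  through its edge at \<open>e\<close>-coordinate 0; moving along \<open>-e\<close>, only through
  the one at 1. If \<open>u\<close> is off the translates of that edge, it has positive distance
  from them, so a short move does not enter.\<close>

lemma one_sided_avoidance:
  fixes e x u :: "real^2" and \<sigma> :: real
  defines "S \<equiv> (if \<sigma> = 1 then closed_segment 0 x else closed_segment e (e + x))"
  assumes "\<sigma> = 1 \<or> \<sigma> = -1"
    and "torus_proj u \<notin> torus_proj ` parallelogram e x"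
    and "torus_proj u \<notin> torus_proj ` S"
  shows "\<exists>\<delta>>0. \<forall>s. 0 < s \<and> s < \<delta> \<longrightarrow>
    torus_proj (u + (\<sigma> * s) *\<^sub>R e) \<notin> torus_proj ` parallelogram e x"
proof -
  have "compact S"
    by (simp add: S_def)
  from this assms(4) obtain \<delta> where \<delta>: "\<delta> > 0"
    "\<And>r. \<bar>r\<bar> < \<delta> \<Longrightarrow> torus_proj (u + r *\<^sub>R e) \<notin> torus_proj ` S"
    by (rule away_from_translates[where e = e]) blast
  have False if s: "0 < s" "s < \<delta>"
    and "torus_proj (u + (\<sigma> * s) *\<^sub>R e) \<in> torus_proj ` parallelogram e x" for s
  proof -
    from that(3) obtain a b where ab: "0 < a" "a < 1" "0 < b" "b < 1"
      and k: "u + (\<sigma> * s) *\<^sub>R e - (a *\<^sub>R e + b *\<^sub>R x) \<in> int_lattice"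
      by (auto simp: torus_proj_in_image_iff parallelogram_def)
    define a' where "a' = a - \<sigma> * s"
    have k': "u - (a' *\<^sub>R e + b *\<^sub>R x) \<in> int_lattice"
      using k by (simp add: a'_def algebra_simps)
    have out: "\<not> (0 < a' \<and> a' < 1)"
      using k' ab assms(3) by (auto simp: torus_proj_in_image_iff parallelogram_def)
    \<comment> \<open>The \<open>e\<close>-coordinate of the edge crossed between \<open>a'\<close>
      and \<open>a\<close>; its distance from \<open>a'\<close> is less than
      \<open>s\<close>.\<close>
    define c :: real where "c = (if \<sigma> = 1 then 0 else 1)"
    have "\<bar>c - a'\<bar> < \<delta>"
      using out ab s assms(2) by (auto simp: c_def a'_def)
    then have "torus_proj (u + (c - a') *\<^sub>R e) \<notin> torus_proj ` S"
      by (rule \<delta>(2))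
    moreover have "u + (c - a') *\<^sub>R e - (c *\<^sub>R e + b *\<^sub>R x) \<in> int_lattice"
      using k' by (simp add: algebra_simps)
    moreover have "c *\<^sub>R e + b *\<^sub>R x \<in> S"
    proof -
      have "b *\<^sub>R x \<in> closed_segment 0 x"
        using ab by (auto simp: in_segment intro!: exI[of _ b])
      then have "e + b *\<^sub>R x \<in> closed_segment (e + 0) (e + x)"
        using ab closed_segment_translation_eq[of e "b *\<^sub>R x" 0 x] by simp
      with \<open>b *\<^sub>R x \<in> closed_segment 0 x\<close> show ?thesis
        by (simp add: S_def c_def)
    qed
    ultimately show False
      unfolding torus_proj_in_image_iff by blast
  qed
  with \<delta>(1) show ?thesis
    by blast
qed

text \<open>The line through \<open>p\<close> along \<open>x\<close> cuts the given translate in an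
  open interval of parameter length 1. A segment around \<open>p\<close> that meets this interval
  also contains one of its ends, provided that \<open>p\<close> is outside the interval or that the
  half-length \<open>H\<close> of the segment is at least 1.\<close>

lemma unstable_fibre_meets_stable_edge:
  fixes p e x :: "real^2"
  assumes "torus_proj (p + t *\<^sub>R x) \<in> torus_proj ` parallelogram e x" "\<bar>t\<bar> < H"
    and "torus_proj p \<notin> torus_proj ` parallelogram e x \<or> 1 \<le> H"
  obtains t' a c where "\<bar>t'\<bar> < H" "0 < a" "a < 1" "c = 0 \<or> c = (1::real)"
    "p + t' *\<^sub>R x - (a *\<^sub>R e + c *\<^sub>R x) \<in> int_lattice"
proof -
  from assms(1) obtain a b where ab: "0 < a" "a < 1" "0 < b" "b < 1"
    and k: "p + t *\<^sub>R x - (a *\<^sub>R e + b *\<^sub>R x) \<in> int_lattice"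
    by (auto simp: torus_proj_in_image_iff parallelogram_def)
  have k': "p - (a *\<^sub>R e + (b - t) *\<^sub>R x) \<in> int_lattice"
    using k by (simp add: algebra_simps)
  have outside: "\<not> (0 < b - t \<and> b - t < 1) \<or> 1 \<le> H"
    using assms(3) ab k' unfolding torus_proj_in_image_iff parallelogram_def by blast
  \<comment> \<open>The end of the interval reached from \<open>t\<close> by going back towards the
    centre of the segment and, if necessary, beyond it.\<close>
  define c :: real where "c = (if 0 \<le> t then 0 else 1)"
  show ?thesis
  proof (rule that[of "t - b + c" a c])
    show "\<bar>t - b + c\<bar> < H"
      using outside ab assms(2) by (auto simp: c_def)
    show "p + (t - b + c) *\<^sub>R x - (a *\<^sub>R e + c *\<^sub>R x) \<in> int_lattice"
      using k by (simp add: algebra_simps)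
  qed (use ab in \<open>auto simp: c_def\<close>)
qed

text \<open>A visit to the edge at the origin followed by, or simultaneous with, a visit to the
  opposite edge is excluded by the generic width. In the reverse order, the inverse map contracts
  the edge at the origin into itself, so the earlier point lies on both edges, which is excluded by
  the case of zero iterates.\<close>

lemma unstable_edges_not_both_hit:
  assumes inj: "inj (toral_map A)"
    and Ax: "map_matrix of_int A *v x = m *\<^sub>R x" and m: "1 < m"
    and gen: "generic_width A e x"
  shows "(\<forall>n. (toral_map A ^^ n) z \<notin> torus_proj ` closed_segment 0 x) \<or>
    (\<forall>n. (toral_map A ^^ n) z \<notin> torus_proj ` closed_segment e (e + x))"
proof (rule ccontr)
  have disjoint: "(toral_map A ^^ k) u \<notin> torus_proj ` closed_segment e (e + x)"
    if "u \<in> torus_proj ` closed_segment 0 x" for k u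
    using gen imageI[OF that, of "toral_map A ^^ k"] unfolding generic_width_def disjoint_iff
    by simp
  assume "\<not> ?thesis"
  then obtain n n' where n: "(toral_map A ^^ n) z \<in> torus_proj ` closed_segment 0 x"
    and n': "(toral_map A ^^ n') z \<in> torus_proj ` closed_segment e (e + x)"
    by blast
  show False
  proof (cases "n \<le> n'")
    case True
    then have "(toral_map A ^^ (n' - n)) ((toral_map A ^^ n) z) = (toral_map A ^^ n') z"
      by (rule funpow_diff_apply)
    then show False
      using disjoint[OF n, of "n' - n"] n' by simp
  next
    case False
    define k where "k = n - n'"
    have "(toral_map A ^^ k) ((toral_map A ^^ n') z) = (toral_map A ^^ n) z"
      using False by (simp add: k_def funpow_diff_apply)
    moreover from n obtain t where t: "0 \<le> t" "t \<le> 1" "(toral_map A ^^ n) z = torus_proj (t *\<^sub>R x)"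
      by (auto simp: in_segment)
    moreover have "(toral_map A ^^ k) (torus_proj ((t / m ^ k) *\<^sub>R x)) = torus_proj (t *\<^sub>R x)"
      using m by (simp add: toral_map_funpow_eigen[OF Ax])
    moreover have "inj (toral_map A ^^ k)"
      using inj by (rule inj_fn)
    ultimately have "(toral_map A ^^ n') z = torus_proj ((t / m ^ k) *\<^sub>R x)"
      by (metis injD)
    moreover have "(t / m ^ k) *\<^sub>R x \<in> closed_segment 0 x"
    proof -
      have "1 \<le> m ^ k"
        using m by simp
      with t(2) have "t \<le> m ^ k"
        by linarith
      then have "0 \<le> t / m ^ k" "t / m ^ k \<le> 1"
        using t(1) m by (simp_all add: divide_le_eq)
      then show ?thesis
        by (auto simp: in_segment intro!: exI[of _ "t / m ^ k"])
    qed
    ultimately have "(toral_map A ^^ n') z \<in> torus_proj ` closed_segment 0 x"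
      by simp
    then show False
      using disjoint[of _ 0] n' by simp
  qed
qed

section \<open>A stable piece near a given point of the avoiding set\<close>

lemma stable_piece_near_avoiding_point:
  fixes A :: "int^2^2" and e x :: "real^2"
  defines "T \<equiv> toral_map A" and "B \<equiv> torus_proj ` parallelogram e x"
  assumes Ae: "map_matrix of_int A *v e = l *\<^sub>R e" and l: "0 < l" "l < 1" and "e \<noteq> 0"
    and Ax: "map_matrix of_int A *v x = m *\<^sub>R x" and m: "1 < m"
    and inj: "inj (toral_map A)" and gen: "generic_width A e x"
    and edges: "\<And>n a c. 0 < a \<Longrightarrow> a < 1 \<Longrightarrow> c = 0 \<or> c = (1::real) \<Longrightarrow>
      (T ^^ n) (torus_proj (a *\<^sub>R e + c *\<^sub>R x)) \<notin> B"
    and z: "z \<in> avoiding_set T B" and W: "open W" "z \<in> W"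
  shows "\<exists>X. stable_piece A X \<and> X \<subseteq> avoiding_set T B \<inter> W"
proof -
  let ?M = "\<lambda>n. (*v) (map_matrix of_int A) ^^ n :: real^2 \<Rightarrow> real^2"
  obtain v where v: "z = torus_proj v"
    using torus_proj_surj by blast
  have Tp: "(T ^^ n) (torus_proj u) = torus_proj (?M n u)" for n u
    by (simp add: T_def toral_map_funpow_proj)
  have zB: "torus_proj (?M n v) \<notin> B" for n
    using z Tp by (auto simp: avoiding_set_def v)
  obtain \<sigma> :: real where \<sigma>: "\<sigma> = 1 \<or> \<sigma> = -1"
    and S: "\<And>n. torus_proj (?M n v) \<notin>
      torus_proj ` (if \<sigma> = 1 then closed_segment 0 x else closed_segment e (e + x))"
    using unstable_edges_not_both_hit[OF inj Ax m gen, of z]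
  proof
    assume "\<forall>n. (toral_map A ^^ n) z \<notin> torus_proj ` closed_segment 0 x"
    then show ?thesis
      using that[of 1] by (simp add: v toral_map_funpow_proj)
  next
    assume "\<forall>n. (toral_map A ^^ n) z \<notin> torus_proj ` closed_segment e (e + x)"
    then show ?thesis
      using that[of "-1"] by (simp add: v toral_map_funpow_proj)
  qed
  have "\<forall>n. \<exists>\<delta>>0. \<forall>s. 0 < s \<and> s < \<delta> \<longrightarrow> torus_proj (?M n v + (\<sigma> * s) *\<^sub>R e) \<notin> B"
    unfolding B_def using one_sided_avoidance[OF \<sigma> zB[unfolded B_def] S] by blast
  then obtain d where d: "\<And>n. d n > 0"
    "\<And>n s. 0 < s \<Longrightarrow> s < d n \<Longrightarrow> torus_proj (?M n v + (\<sigma> * s) *\<^sub>R e) \<notin> B"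
    by metis
  obtain r where r: "r > 0" "ball v r \<subseteq> torus_proj -` W"
    using W unfolding open_torus_def v open_contains_ball by blast
  \<comment> \<open>With this size, displacements of at most \<open>h\<close> along both
    \<open>e\<close> and \<open>x\<close> stay within distance \<open>r\<close> of \<open>v\<close>,
    hence in \<open>W\<close>.\<close>
  define h where "h = r / (norm e + norm x + 1)"
  have pos: "norm e + norm x + 1 > 0"
    by (simp add: add_nonneg_pos)
  have h: "h > 0"
    using r pos by (simp add: h_def)
  \<comment> \<open>From time \<open>N\<close> on, the image of an unstable fibre of half-length
    \<open>h\<close> has half-length more than 1 in units of \<open>x\<close>, too long to fit into
    a translate of the parallelogram.\<close>
  obtain N where N: "1 / h < m ^ N"
    using real_arch_pow[OF m] by blast
  \<comment> \<open>The box is narrow enough for the one-sided avoidance at each of the times before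
    \<open>N\<close>. Inserting \<open>h\<close> bounds the width and keeps the minimum meaningful
    for \<open>N = 0\<close>.\<close>
  define \<delta> where "\<delta> = Min (insert h (d ` {..<N}))"
  have \<delta>: "\<delta> > 0" "\<delta> \<le> h" "\<And>n. n < N \<Longrightarrow> \<delta> \<le> d n"
    using h d(1) by (auto simp: \<delta>_def)
  define V where "V = {v + (\<sigma> * s) *\<^sub>R e + t *\<^sub>R x | s t. 0 < s \<and> s < \<delta> \<and> \<bar>t\<bar> < h}"
  have VW: "torus_proj w \<in> W" if "w \<in> V" for w
  proof -
    from that obtain s t where w: "w = v + (\<sigma> * s) *\<^sub>R e + t *\<^sub>R x" and st: "0 < s" "s < \<delta>" "\<bar>t\<bar> < h"
      by (auto simp: V_def)
    have "norm ((\<sigma> * s) *\<^sub>R e + t *\<^sub>R x) \<le> s * norm e + \<bar>t\<bar> * norm x"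
      using norm_triangle_ineq[of "(\<sigma> * s) *\<^sub>R e" "t *\<^sub>R x"] \<sigma> st by auto
    also have "\<dots> \<le> h * norm e + h * norm x"
      using st \<delta> by (intro add_mono mult_right_mono) auto
    also have "\<dots> < h * (norm e + norm x + 1)"
      using h by (simp add: algebra_simps)
    also have "\<dots> = r"
      using pos by (simp add: h_def)
    finally have "norm (w - v) < r"
      by (simp add: w algebra_simps)
    then show ?thesis
      using r(2) by (auto simp: dist_norm norm_minus_commute)
  qed
  have shift: "v + (\<sigma> * s) *\<^sub>R e + t *\<^sub>R x + r *\<^sub>R e \<in> V"
    if "\<bar>r\<bar> < min s (\<delta> - s)" "\<bar>t\<bar> < h" for s t r
  proof -
    have "\<sigma> * \<sigma> = 1"
      using \<sigma> by auto
    then have "v + (\<sigma> * s) *\<^sub>R e + t *\<^sub>R x + r *\<^sub>R e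
        = v + (\<sigma> * (s + \<sigma> * r)) *\<^sub>R e + t *\<^sub>R x"
      by (simp add: algebra_simps flip: mult.assoc)
    moreover have "0 < s + \<sigma> * r" "s + \<sigma> * r < \<delta>"
      using that \<sigma> by auto
    ultimately show ?thesis
      unfolding V_def using that(2) by blast
  qed
  \<comment> \<open>It suffices to find a stable interval of avoiding points centred in the box; the
    bound on \<open>\<rho>\<close> keeps it inside the box.\<close>
  have "\<exists>s t \<rho>. 0 < s \<and> s < \<delta> \<and> \<bar>t\<bar> < h \<and> 0 < \<rho> \<and> \<rho> \<le> min s (\<delta> - s) \<and>
    (\<forall>r. \<bar>r\<bar> < \<rho> \<longrightarrow>
      torus_proj (v + (\<sigma> * s) *\<^sub>R e + t *\<^sub>R x + r *\<^sub>R e) \<in> avoiding_set T B)"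
  proof (cases "\<exists>n. \<exists>w\<in>V. torus_proj (?M n w) \<in> B")
    case False
    then have "torus_proj w \<in> avoiding_set T B" if "w \<in> V" for w
      using that by (auto simp: avoiding_set_def Tp)
    then show ?thesis
      using \<delta>(1) h shift[where s = "\<delta> / 2" and t = 0]
      by (intro exI[of _ "\<delta> / 2"] exI[where x = "0::real"] conjI allI impI) auto
  next
    case True
    \<comment> \<open>Before this first time no point of the whole box enters \<open>B\<close>, so
      only the times from \<open>n\<close> on need attention.\<close>
    define n where "n = (LEAST n. \<exists>w\<in>V. torus_proj (?M n w) \<in> B)"
    have "\<exists>w\<in>V. torus_proj (?M n w) \<in> B"
      unfolding n_def using True by (rule LeastI_ex)
    then obtain s t where st: "0 < s" "s < \<delta>" "\<bar>t\<bar> < h"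
      and "torus_proj (?M n (v + (\<sigma> * s) *\<^sub>R e + t *\<^sub>R x)) \<in> B"
      by (auto simp: V_def)
    \<comment> \<open>The image at time \<open>n\<close> of the centre of the unstable fibre that
      contains the entering point.\<close>
    define p where "p = ?M n v + (l ^ n * (\<sigma> * s)) *\<^sub>R e"
    have M_V: "?M n (v + s' *\<^sub>R e + t' *\<^sub>R x)
      = ?M n v + (l ^ n * s') *\<^sub>R e + (m ^ n * t') *\<^sub>R x" for s' t'
      by (rule funpow_eigen[OF Ae Ax])
    have pB: "torus_proj (p + (m ^ n * t) *\<^sub>R x) \<in> torus_proj ` parallelogram e x"
      using \<open>_ \<in> B\<close> by (simp add: M_V p_def B_def)
    have mn: "m ^ n > 0" and ln: "l ^ n > 0" "l ^ n \<le> 1"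
      using m l by (auto intro: power_le_one)
    have tH: "\<bar>m ^ n * t\<bar> < m ^ n * h"
      using st mn by (simp add: abs_mult)
    \<comment> \<open>For early times the centre is still close enough to the orbit of
      \<open>v\<close>, on the side \<open>\<sigma>\<close>, to stay outside \<open>B\<close>; for
      late times the fibre is too long.\<close>
    have "torus_proj p \<notin> torus_proj ` parallelogram e x \<or> 1 \<le> m ^ n * h"
    proof (cases "n < N")
      case True
      have "l ^ n * s < d n"
      proof -
        have "l ^ n * s \<le> s"
          using ln st by (simp add: mult_left_le_one_le)
        then show ?thesis
          using st \<delta>(3)[OF True] by linarith
      qed
      then have "torus_proj (?M n v + (\<sigma> * (l ^ n * s)) *\<^sub>R e) \<notin> B"
        using ln st by (intro d(2)) auto
      then show ?thesis
        by (simp add: p_def B_def mult_ac)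
    next
      case False
      then have "m ^ N \<le> m ^ n"
        using m by (intro power_increasing) auto
      then have "1 / h < m ^ n"
        using N by linarith
      then show ?thesis
        using h by (simp add: pos_divide_less_eq)
    qed
    with pB tH obtain t0 a c where t0: "\<bar>t0\<bar> < m ^ n * h" and a: "0 < a" "a < 1"
      and c: "c = 0 \<or> c = (1::real)"
      and k: "p + t0 *\<^sub>R x - (a *\<^sub>R e + c *\<^sub>R x) \<in> int_lattice"
      by (rule unstable_fibre_meets_stable_edge)
    \<comment> \<open>The point of the fibre whose image at time \<open>n\<close> lies on a stable
      edge of a translate of the parallelogram.\<close>
    define t' where "t' = t0 / m ^ n"
    have t': "\<bar>t'\<bar> < h" "m ^ n * t' = t0"
      using t0 mn m by (auto simp: t'_def abs_divide pos_divide_less_eq mult_ac)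
    \<comment> \<open>The first bound keeps the interval in the box. The second keeps its image on
      the open stable edge, since \<open>l ^ n \<le> 1\<close>.\<close>
    define \<rho> where "\<rho> = min (min s (\<delta> - s)) (min a (1 - a))"
    have "torus_proj (v + (\<sigma> * s) *\<^sub>R e + t' *\<^sub>R x + r *\<^sub>R e) \<in> avoiding_set T B"
      (is "torus_proj ?w \<in> _") if r: "\<bar>r\<bar> < \<rho>" for r
    proof -
      have "?w \<in> V"
        using r t'(1) by (intro shift) (auto simp: \<rho>_def)
      have w: "?w = v + (\<sigma> * s + r) *\<^sub>R e + t' *\<^sub>R x"
        by (simp add: algebra_simps)
      have "?M n ?w = p + t0 *\<^sub>R x + (l ^ n * r) *\<^sub>R e"
        unfolding w M_V p_def t'(2) by (simp add: algebra_simps)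
      then have "torus_proj (?M n ?w) = torus_proj ((a + l ^ n * r) *\<^sub>R e + c *\<^sub>R x)"
        using k by (intro torus_proj_lattice) (simp add: algebra_simps)
      moreover have "0 < a + l ^ n * r" "a + l ^ n * r < 1"
      proof -
        have "\<bar>l ^ n * r\<bar> \<le> \<bar>r\<bar>"
          using ln by (simp add: abs_mult mult_left_le_one_le)
        then show "0 < a + l ^ n * r" "a + l ^ n * r < 1"
          using r by (auto simp: \<rho>_def)
      qed
      ultimately have later: "(T ^^ j) (torus_proj (?M n ?w)) \<notin> B" for j
        using edges c by simp
      \<comment> \<open>Minimality of \<open>n\<close> settles the earlier times; afterwards the
        point has reached a stable edge, whose forward images avoid \<open>B\<close>.\<close>
      have "(T ^^ i) (torus_proj ?w) \<notin> B" for i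
      proof (cases "i < n")
        case True
        then show ?thesis
          using not_less_Least[of i "\<lambda>n. \<exists>w\<in>V. torus_proj (?M n w) \<in> B"] \<open>?w \<in> V\<close>
          unfolding n_def Tp by blast
      next
        case False
        then have "(T ^^ i) (torus_proj ?w) = (T ^^ (i - n)) ((T ^^ n) (torus_proj ?w))"
          by (simp add: funpow_diff_apply)
        then show ?thesis
          using later Tp by simp
      qed
      then show ?thesis
        by (simp add: avoiding_set_def)
    qed
    moreover have "0 < \<rho>" "\<rho> \<le> min s (\<delta> - s)"
      using st a by (auto simp: \<rho>_def)
    ultimately show ?thesis
      using st t' by blast
  qed
  then obtain s t \<rho> where st: "0 < s" "s < \<delta>" "\<bar>t\<bar> < h" and \<rho>: "0 < \<rho>" "\<rho> \<le> min s (\<delta> - s)"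
    and avoid: "\<And>r. \<bar>r\<bar> < \<rho> \<Longrightarrow>
      torus_proj (v + (\<sigma> * s) *\<^sub>R e + t *\<^sub>R x + r *\<^sub>R e) \<in> avoiding_set T B"
    by blast
  define w where "w = v + (\<sigma> * s) *\<^sub>R e + t *\<^sub>R x"
  \<comment> \<open>One half of the stable interval around \<open>w\<close> is enough.\<close>
  define X where "X = (+) (torus_proj w) ` torus_proj ` open_segment 0 (\<rho> *\<^sub>R e)"
  have line: "r *\<^sub>R e \<in> contracting_line A" for r
    unfolding contracting_line_def using l
    by (intro CollectI exI[of _ l]) (simp add: Ae matrix_vector_mult_scaleR mult_ac)
  have "stable_piece A X"
    unfolding stable_piece_def X_def using line[of 0] line \<open>e \<noteq> 0\<close> \<rho>
    by (intro exI[of _ "torus_proj w"] exI[of _ "torus_proj ` open_segment 0 (\<rho> *\<^sub>R e)"]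
      exI[of _ 0] exI[of _ "\<rho> *\<^sub>R e"]) auto
  moreover have "X \<subseteq> avoiding_set T B \<inter> W"
  proof
    fix y assume "y \<in> X"
    then obtain u where u: "0 < u" "u < 1" "y = torus_proj w + torus_proj ((u * \<rho>) *\<^sub>R e)"
      by (auto simp: X_def in_segment)
    then have y: "y = torus_proj (w + (u * \<rho>) *\<^sub>R e)"
      by (simp add: plus_torus.abs_eq)
    have "\<bar>u * \<rho>\<bar> < \<rho>"
      using u \<rho> by simp
    then show "y \<in> avoiding_set T B \<inter> W"
      using avoid VW shift st \<rho> unfolding y w_def by simp
  qed
  ultimately show ?thesis
    by blast
qed

section \<open>Forward images of the stable edges of the constructed parallelogram\<close>

lemma stable_ball_toral_map:
  assumes "u \<in> stable_ball A r z"
  shows "toral_map A u \<in> stable_ball A r (toral_map A z)"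
proof -
  from assms obtain v where v: "v \<in> contracting_line A" "norm v \<le> r" "u = z + torus_proj v"
    by (auto simp: stable_ball_def)
  let ?Av = "map_matrix of_int A *v v"
  from v(1) obtain l where l: "\<bar>l\<bar> < 1" "?Av = l *\<^sub>R v"
    by (auto simp: contracting_line_def)
  have "?Av \<in> contracting_line A"
    unfolding contracting_line_def using l by (auto simp: matrix_vector_mult_scaleR)
  moreover have "norm ?Av \<le> r"
  proof -
    have "\<bar>l\<bar> * norm v \<le> norm v"
      using l(1) by (simp add: mult_left_le_one_le)
    then show ?thesis
      using l(2) v(2) by simp
  qed
  moreover have "toral_map A u = toral_map A z + torus_proj ?Av"
    using torus_proj_surj[of z]
    by (auto simp: v(3) plus_torus.abs_eq toral_map.abs_eq matrix_vector_right_distrib)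
  ultimately show ?thesis
    unfolding stable_ball_def by blast
qed

text \<open>Each iterate shortens stable distances and moves the centre one step along the periodic
  orbit, so the union of the balls is forward invariant. This controls the stable edge at
  \<open>x\<close>.\<close>

lemma stable_ball_funpow_periodic:
  assumes "\<And>p. y p = (toral_map A ^^ p) z" "0 < N" "y N = y 0" "u \<in> stable_ball A r (y q)" "q < N"
  shows "\<exists>p<N. (toral_map A ^^ n) u \<in> stable_ball A r (y p)"
proof (induction n)
  case 0
  then show ?case
    using assms by auto
next
  case (Suc n)
  then obtain p where p: "p < N" "(toral_map A ^^ n) u \<in> stable_ball A r (y p)"
    by blast
  then have "(toral_map A ^^ Suc n) u \<in> stable_ball A r (y (Suc p))"
    using stable_ball_toral_map[OF p(2)] by (simp add: assms(1))
  then show ?case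
    using p(1) assms(2,3) by (cases "Suc p = N") (auto intro: Suc_lessI)
qed

text \<open>Eigenvectors for distinct eigenvalues are independent, whereas every point of the
  parallelogram has a positive \<open>x\<close>-component.\<close>

lemma eigenvector_in_parallelogram:
  fixes M :: "real^2^2"
  assumes "M *v e = l *\<^sub>R e" "M *v x = m *\<^sub>R x" "l \<noteq> m" "x \<noteq> 0"
  shows "r *\<^sub>R e \<notin> parallelogram e x"
proof
  assume "r *\<^sub>R e \<in> parallelogram e x"
  then obtain a b where b: "0 < b" and eq: "r *\<^sub>R e = a *\<^sub>R e + b *\<^sub>R x"
    by (auto simp: parallelogram_def)
  from eq have bx: "b *\<^sub>R x = (r - a) *\<^sub>R e"
    by (simp add: algebra_simps)
  have "m *\<^sub>R (b *\<^sub>R x) = M *v (b *\<^sub>R x)"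
    by (simp add: assms(2) matrix_vector_mult_scaleR mult_ac)
  also have "\<dots> = l *\<^sub>R (b *\<^sub>R x)"
    by (simp add: bx assms(1) matrix_vector_mult_scaleR mult_ac)
  finally have "((m - l) * b) *\<^sub>R x = 0"
    by (simp add: algebra_simps)
  then show False
    using assms(3,4) b by simp
qed

lemma parallelogram_mono:
  assumes "0 < c" "c \<le> 1" "0 < c'" "c' \<le> 1"
  shows "parallelogram (c *\<^sub>R e) (c' *\<^sub>R x) \<subseteq> parallelogram e x"
proof
  fix p assume "p \<in> parallelogram (c *\<^sub>R e) (c' *\<^sub>R x)"
  then obtain s t where st: "0 < s" "s < 1" "0 < t" "t < 1"
    and p: "p = (s * c) *\<^sub>R e + (t * c') *\<^sub>R x"
    by (auto simp: parallelogram_def)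
  have "s * c < 1" "t * c' < 1"
    using assms st mult_left_le[of c s] mult_left_le[of c' t] by linarith+
  then show "p \<in> parallelogram e x"
    unfolding parallelogram_def p using assms st
    by (intro CollectI exI[of _ "s * c"] exI[of _ "t * c'"]) auto
qed

text \<open>The point is the limit of \<open>s *\<^sub>R e + t *\<^sub>R x\<close> as
  \<open>t\<close> decreases to 0. This places the stable edge at the origin in the region where the
  torus projection is injective.\<close>

lemma edge_in_closure_parallelogram:
  assumes "0 < s" "s < 1"
  shows "s *\<^sub>R e \<in> closure (parallelogram e x)"
proof -
  let ?f = "\<lambda>t::real. s *\<^sub>R e + t *\<^sub>R x"
  have "?f ` closure {0<..<1} \<subseteq> closure (parallelogram e x)"
  proof (rule image_closure_subset)
    show "?f ` {0<..<1} \<subseteq> closure (parallelogram e x)"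
      using assms closure_subset[of "parallelogram e x"] by (force simp: parallelogram_def)
  qed (auto intro!: continuous_intros)
  moreover have "?f 0 \<in> ?f ` closure {0<..<1}"
    by (intro imageI) simp
  ultimately show ?thesis
    by auto
qed

theorem lemma3p2:
  fixes A :: "int^2^2" and e x :: "real^2" and B F U :: "torus set"
  assumes "hyperbolic A"
    and "\<And>c. is_eigenvalue A c \<Longrightarrow> c \<in> \<real> \<and> 0 < Re c"
    and "constructed A e x"
    and "B = torus_proj ` parallelogram e x"
    and "generic_width A e x"
    and "F = avoiding_set (toral_map A) B"
    and "openin (top_of_set F) U" and "U \<noteq> {}"
  shows "\<exists>X. stable_piece A X \<and> X \<subseteq> U"
proof -
  obtain em ep w N y \<beta> q
    where em: "em \<in> contracting_line A" "em \<noteq> 0" and ep: "ep \<in> expanding_line A" "ep \<noteq> 0"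
    and ball: "closure (parallelogram em ep) \<subseteq> ball 0 (1/4)"
    and y: "\<forall>p. y p = (toral_map A ^^ p) (torus_proj w)" and N: "0 < N" "y N = y 0"
    and q: "q < N"
    and x: "x \<in> closed_segment 0 ep" and e: "e \<in> closed_segment 0 em" "e \<noteq> 0"
    and top_edge: "torus_proj ` closed_segment x (x + e) \<subseteq> stable_ball A \<beta> (y q)"
    and disjoint: "\<forall>p<N. torus_proj ` parallelogram e x \<inter> stable_ball A \<beta> (y p) = {}"
    using assms(3) unfolding constructed_def
    apply (elim exE conjE)
    subgoal premises prems for em ep w N y \<alpha> \<alpha>min I \<beta> q
    proof -
      have "q < N"
        using prems(17,19) by simp
      then show ?thesis
        by (rule prems(1)[OF prems(2-6,11-13) _ prems(21,24-27)])
    qed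
    done
  have scale: "\<exists>c. 0 < c \<and> c \<le> 1 \<and> u = c *\<^sub>R v" if "u \<in> closed_segment 0 v" "u \<noteq> 0"
    for u v :: "real^2"
  proof -
    from that(1) obtain c where c: "0 \<le> c" "c \<le> 1" "u = c *\<^sub>R v"
      by (auto simp: in_segment)
    with that(2) have "c \<noteq> 0"
      by auto
    with c show ?thesis
      by (intro exI[of _ c]) simp
  qed
  obtain ce where ce: "0 < ce" "ce \<le> 1" "e = ce *\<^sub>R em"
    using scale[OF e] by blast
  have top_mem: "a *\<^sub>R e + x \<in> closed_segment x (x + e)" if "0 < a" "a < 1" for a
    using that by (auto simp: in_segment algebra_simps intro!: exI[of _ a])
  \<comment> \<open>For \<open>x = 0\<close> the parallelogram would degenerate to an open segment
    inside the edge \<open>closed_segment x (x + e)\<close>, hence inside a ball that it must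
    avoid.\<close>
  have "x \<noteq> 0"
  proof
    assume [simp]: "x = 0"
    have "(1/2) *\<^sub>R e \<in> parallelogram e x"
      unfolding parallelogram_def by (intro CollectI exI[of _ "1/2"]) simp
    moreover have "(1/2) *\<^sub>R e \<in> closed_segment x (x + e)"
      using top_mem[of "1/2"] by simp
    ultimately show False
      using top_edge disjoint q by blast
  qed
  then obtain cx where cx: "0 < cx" "cx \<le> 1" "x = cx *\<^sub>R ep"
    using scale[OF x] by blast
  have positive: "0 < l" if "map_matrix of_int A *v u = l *\<^sub>R (u :: real^2)" "u \<noteq> 0" for u l
    using assms(2)[OF real_eigenvector_is_eigenvalue[OF that]] by simp
  obtain l where l: "\<bar>l\<bar> < 1" and Aem: "map_matrix of_int A *v em = l *\<^sub>R em"
    using em(1) by (auto simp: contracting_line_def)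
  with positive[OF Aem em(2)] have l: "0 < l" "l < 1"
    by auto
  obtain m where m: "1 < \<bar>m\<bar>" and Aep: "map_matrix of_int A *v ep = m *\<^sub>R ep"
    using ep(1) by (auto simp: expanding_line_def)
  with positive[OF Aep ep(2)] have m: "1 < m"
    by auto
  have Ae: "map_matrix of_int A *v e = l *\<^sub>R e" and Ax: "map_matrix of_int A *v x = m *\<^sub>R x"
    by (simp_all add: ce(3) cx(3) matrix_vector_mult_scaleR Aem Aep mult_ac)
  have edges: "(toral_map A ^^ n) (torus_proj (a *\<^sub>R e + c *\<^sub>R x)) \<notin> torus_proj ` parallelogram e x"
    if a: "0 < a" "a < 1" and c: "c = 0 \<or> c = (1::real)" for n a c
  proof (cases "c = 0")
    case False
    \<comment> \<open>The edge at \<open>x\<close> lies in a ball around a point of the periodic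
      orbit; its images remain in such balls, all of which miss the parallelogram.\<close>
    then have "torus_proj (a *\<^sub>R e + c *\<^sub>R x) \<in> stable_ball A \<beta> (y q)"
      using top_edge top_mem[OF a] c by auto
    then show ?thesis
      using stable_ball_funpow_periodic[OF y[rule_format] N _ q] disjoint by blast
  next
    case True
    \<comment> \<open>The edge at the origin is contracted into itself. Its points lie outside the
      parallelogram in the plane, and injectivity of the projection on the small ball transfers this
      to the torus.\<close>
    define r where "r = l ^ n * a"
    have "l ^ n \<le> 1" "0 < l ^ n"
      using l by (auto intro: power_le_one)
    then have r: "0 < r" "r < 1"
      using a mult_left_le_one_le[of a "l ^ n"] unfolding r_def by (simp_all, linarith)
    have "r * ce < 1"
      using r ce(2) mult_left_le[of ce r] by linarith
    then have "r *\<^sub>R e \<in> closure (parallelogram em ep)"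
      using edge_in_closure_parallelogram[of "r * ce" em ep] r ce by simp
    moreover have "parallelogram e x \<subseteq> closure (parallelogram em ep)"
      using parallelogram_mono[of ce cx em ep] ce cx closure_subset by blast
    moreover have "r *\<^sub>R e \<notin> parallelogram e x"
      using eigenvector_in_parallelogram[OF Ae Ax] l m \<open>x \<noteq> 0\<close> by simp
    ultimately have "torus_proj (r *\<^sub>R e) \<notin> torus_proj ` parallelogram e x"
      using inj_on_image_mem_iff[OF torus_proj_inj_on_ball] ball by blast
    then show ?thesis
      using True by (simp add: toral_map_funpow_eigen[OF Ae] r_def)
  qed
  obtain W where W: "open W" "U = F \<inter> W"
    using assms(7) by (auto simp: openin_open)
  then obtain z where "z \<in> F" "z \<in> W"
    using assms(8) by blast
  moreover have "inj (toral_map A)"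
    using assms(1) by (intro toral_map_inj) (simp add: hyperbolic_def)
  ultimately show ?thesis
    using stable_piece_near_avoiding_point[OF Ae l e(2) Ax m _ assms(5) edges, of z W] W(1)
    unfolding W(2) assms(4,6) by blast
qed

end
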